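(* Let $R=k[x_1,\dots,x_n]$ be a polynomial ring over a field $k$ and let $I\subset R$ be an arbitrary squarefree monomial ideal. For every integer $s\ge 1$ and every $t\in E(s)$, we have $\operatorname{depth} R/I^{(s)} \ge \operatorname{depth} R/I^{(t)}$, where $$E(s)=\bigcup_{i\ge 1}\{t\in\mathbb{N} \mid i(s-1)+1\le t\le is\}.$$
   Context: For a homogeneous ideal $I$ of $R$ and $t\ge 0$, the $t$-th symbolic power $I^{(t)}$ is the intersection of the primary components of $I^t$ associated with the minimal primes of $I$. *)

theory Defs
  imports "HOL-Library.Poly_Mapping" "HOL-Library.Extended_Nat"
begin

definition is_ideal :: "'a::comm_ring_1 set \<Rightarrow> bool" where
  "is_ideal J \<longleftrightarrow> 0 \<in> J \<and> (\<forall>a\<in>J. \<forall>b\<in>J. a + b \<in> J) \<and> (\<forall>r. \<forall>a\<in>J. r * a \<in> J)"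

definition ideal_gen :: "'a::comm_ring_1 set \<Rightarrow> 'a set" where
  "ideal_gen S = \<Inter>{J. is_ideal J \<and> S \<subseteq> J}"

definition ideal_sum :: "'a::comm_ring_1 set \<Rightarrow> 'a set \<Rightarrow> 'a set" where
  "ideal_sum I J = ideal_gen (I \<union> J)"

fun ideal_pow :: "'a::comm_ring_1 set \<Rightarrow> nat \<Rightarrow> 'a set" where
  "ideal_pow I 0 = UNIV"
| "ideal_pow I (Suc t) = ideal_gen {a * b |a b. a \<in> I \<and> b \<in> ideal_pow I t}"

definition is_prime_ideal :: "'a::comm_ring_1 set \<Rightarrow> bool" where
  "is_prime_ideal P \<longleftrightarrow> is_ideal P \<and> 1 \<notin> P \<and> (\<forall>a b. a * b \<in> P \<longrightarrow> a \<in> P \<or> b \<in> P)"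

definition minimal_primes :: "'a::comm_ring_1 set \<Rightarrow> 'a set set" where
  "minimal_primes I = {P. is_prime_ideal P \<and> I \<subseteq> P \<and>
      (\<forall>Q. is_prime_ideal Q \<and> I \<subseteq> Q \<and> Q \<subseteq> P \<longrightarrow> Q = P)}"

text \<open>The P-primary component of J for a minimal prime P of J is the contraction
  of J R_P, i.e. {f. exists g not in P with g f in J}.  The t-th symbolic power is the
  intersection of these components of I^t over the minimal primes of I.\<close>
definition localized_component :: "'a::comm_ring_1 set \<Rightarrow> 'a set \<Rightarrow> 'a set" where
  "localized_component J P = {f. \<exists>g. g \<notin> P \<and> g * f \<in> J}"

definition symbolic_power :: "'a::comm_ring_1 set \<Rightarrow> nat \<Rightarrow> 'a set" where
  "symbolic_power I t = (\<Inter>P\<in>minimal_primes I. localized_component (ideal_pow I t) P)"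

type_synonym ('v, 'k) mpoly = "('v \<Rightarrow>\<^sub>0 nat) \<Rightarrow>\<^sub>0 'k"

definition monom :: "('v \<Rightarrow>\<^sub>0 nat) \<Rightarrow> ('v, 'k::comm_ring_1) mpoly" where
  "monom m = Poly_Mapping.single m 1"

definition var :: "'v \<Rightarrow> ('v, 'k::comm_ring_1) mpoly" where
  "var v = monom (Poly_Mapping.single v 1)"

definition max_ideal :: "('v::finite, 'k::comm_ring_1) mpoly set" where
  "max_ideal = ideal_gen (range var)"

definition squarefree_monomial_ideal :: "('v::finite, 'k::field) mpoly set \<Rightarrow> bool" where
  "squarefree_monomial_ideal I \<longleftrightarrow>
     (\<exists>G. (\<forall>m\<in>G. \<forall>v. Poly_Mapping.lookup m v \<le> 1) \<and> I = ideal_gen (monom ` G))"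

definition regular_seq :: "('v::finite, 'k::field) mpoly set \<Rightarrow> ('v, 'k) mpoly list \<Rightarrow> bool" where
  "regular_seq J fs \<longleftrightarrow> set fs \<subseteq> max_ideal \<and>
     (\<forall>i<length fs. \<forall>g. g * fs ! i \<in> ideal_sum J (ideal_gen (set (take i fs)))
                          \<longrightarrow> g \<in> ideal_sum J (ideal_gen (set (take i fs)))) \<and>
     1 \<notin> ideal_sum J (ideal_gen (set fs))"

text \<open>depth R/J (the zero module R/R has depth infinity by convention).\<close>
definition depth_quot :: "('v::finite, 'k::field) mpoly set \<Rightarrow> enat" where
  "depth_quot J = (if 1 \<in> J then \<infinity> else Sup {enat (length fs) |fs. regular_seq J fs})"

definition E_set :: "nat \<Rightarrow> nat set" where
  "E_set s = (\<Union>i\<in>{i. i \<ge> 1}. {t. i * (s - 1) + 1 \<le> t \<and> t \<le> i * s})"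

end

theory Submission
  imports Defs "HOL-Computational_Algebra.Primes"
begin

text \<open>An integer \<open>t\<close> lies in \<open>E(s)\<close> iff \<open>s = \<lceil>t / m\<rceil>\<close> for some \<open>m \<ge> 1\<close>. The endomorphism \<open>\<phi>\<close> with
  \<open>x\<^sub>v \<mapsto> x\<^sub>v ^ m\<close> then satisfies \<open>\<phi> f \<in> I\<^sup>(\<^sup>t\<^sup>) \<longleftrightarrow> f \<in> I\<^sup>(\<^sup>s\<^sup>)\<close>, because membership of a monomial in a symbolic power
  is a family of conditions \<open>\<Sum>v\<in>F. a v \<ge> t\<close>, and \<open>\<phi>\<close> is split by the projection onto the monomials with
  exponents divisible by \<open>m\<close>. Hence elements whose images under \<open>\<phi>\<close> form a regular sequence on
  \<open>R/I\<^sup>(\<^sup>t\<^sup>)\<close> form a regular sequence on \<open>R/I\<^sup>(\<^sup>s\<^sup>)\<close>. It remains to replace an arbitrary regular sequence in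
  the maximal ideal by one of the same length in the image of \<open>\<phi>\<close>. Prime avoidance gives an element \<open>z\<close>
  of the image that is a nonzerodivisor modulo each proper prefix \<open>f\<^sub>1, \<dots>, f\<^sub>i\<close>, and then
  \<open>z, f\<^sub>1, \<dots>, f\<^sub>d\<^sub>-\<^sub>1\<close> is again regular; repeat modulo \<open>z\<close>.\<close>

section \<open>Ideals and associated primes\<close>

lemma is_idealD:
  assumes "is_ideal J"
  shows "0 \<in> J" "a \<in> J \<Longrightarrow> b \<in> J \<Longrightarrow> a + b \<in> J" "a \<in> J \<Longrightarrow> r * a \<in> J" "a \<in> J \<Longrightarrow> a * r \<in> J"
  using assms by (simp_all add: is_ideal_def mult.commute[of a r])

lemma is_ideal_uminus: "is_ideal J \<Longrightarrow> a \<in> J \<Longrightarrow> - a \<in> J"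
  using is_idealD(3)[of J a "-1"] by simp

lemma is_ideal_diff: "is_ideal J \<Longrightarrow> a \<in> J \<Longrightarrow> b \<in> J \<Longrightarrow> a - b \<in> J"
  using is_idealD(2)[of J a "- b"] is_ideal_uminus[of J b] by simp

lemma is_ideal_sum: "is_ideal J \<Longrightarrow> (\<And>x. x \<in> A \<Longrightarrow> f x \<in> J) \<Longrightarrow> sum f A \<in> J"
  by (induction A rule: infinite_finite_induct) (auto intro: is_idealD)

lemma is_ideal_prod: "is_ideal J \<Longrightarrow> finite A \<Longrightarrow> x \<in> A \<Longrightarrow> f x \<in> J \<Longrightarrow> prod f A \<in> J"
  by (simp add: prod.remove is_idealD)

lemma is_ideal_ideal_gen: "is_ideal (ideal_gen S)"
  unfolding ideal_gen_def is_ideal_def by auto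

lemma ideal_gen_superset: "S \<subseteq> ideal_gen S"
  unfolding ideal_gen_def by auto

lemma ideal_gen_least: "is_ideal J \<Longrightarrow> S \<subseteq> J \<Longrightarrow> ideal_gen S \<subseteq> J"
  unfolding ideal_gen_def by auto

lemma ideal_gen_mono: "S \<subseteq> S' \<Longrightarrow> ideal_gen S \<subseteq> ideal_gen S'"
  by (meson ideal_gen_least ideal_gen_superset is_ideal_ideal_gen subset_trans)

lemma ideal_gen_Un_ideal_gen: "ideal_gen (A \<union> ideal_gen B) = ideal_gen (A \<union> B)"
proof
  have "ideal_gen B \<subseteq> ideal_gen (A \<union> B)" by (rule ideal_gen_mono) auto
  then show "ideal_gen (A \<union> ideal_gen B) \<subseteq> ideal_gen (A \<union> B)"
    by (intro ideal_gen_least is_ideal_ideal_gen) (use ideal_gen_superset[of "A \<union> B"] in auto)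
  show "ideal_gen (A \<union> B) \<subseteq> ideal_gen (A \<union> ideal_gen B)"
    by (rule ideal_gen_mono) (use ideal_gen_superset[of B] in auto)
qed

lemma ideal_gen_ideal: "is_ideal J \<Longrightarrow> ideal_gen J = J"
  using ideal_gen_least[of J J] ideal_gen_superset[of J] by auto

lemma ideal_sum_ideal_gen: "ideal_sum J (ideal_gen S) = ideal_gen (J \<union> S)"
  unfolding ideal_sum_def by (rule ideal_gen_Un_ideal_gen)

text \<open>Turns membership in \<open>J + (z)\<close> into an equation, the form in which
  regularity is manipulated below.\<close>

lemma ideal_gen_insert_ideal:
  assumes J: "is_ideal J"
  shows "ideal_gen (insert z J) = {a + r * z |a r. a \<in> J}"
proof
  have "is_ideal {a + r * z |a r. a \<in> J}"
    unfolding is_ideal_def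
  proof (intro conjI ballI allI)
    show "0 \<in> {a + r * z |a r. a \<in> J}"
      using is_idealD(1)[OF J] by (auto intro!: exI[of _ 0])
  next
    fix x y assume "x \<in> {a + r * z |a r. a \<in> J}" "y \<in> {a + r * z |a r. a \<in> J}"
    then obtain a r b q where "x = a + r * z" "y = b + q * z" "a \<in> J" "b \<in> J" by auto
    then have "x + y = (a + b) + (r + q) * z" "a + b \<in> J"
      using J by (auto simp: algebra_simps intro: is_idealD)
    then show "x + y \<in> {a + r * z |a r. a \<in> J}" by blast
  next
    fix c x assume "x \<in> {a + r * z |a r. a \<in> J}"
    then obtain a r where "x = a + r * z" "a \<in> J" by auto
    then have "c * x = c * a + (c * r) * z" "c * a \<in> J"
      using J by (auto simp: algebra_simps intro: is_idealD)
    then show "c * x \<in> {a + r * z |a r. a \<in> J}" by blast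
  qed
  moreover have "insert z J \<subseteq> {a + r * z |a r. a \<in> J}"
  proof
    fix x assume "x \<in> insert z J"
    then have "x = 0 + 1 * z \<or> x = x + 0 * z \<and> x \<in> J" by auto
    then show "x \<in> {a + r * z |a r. a \<in> J}" using is_idealD(1)[OF J] by blast
  qed
  ultimately show "ideal_gen (insert z J) \<subseteq> {a + r * z |a r. a \<in> J}"
    by (rule ideal_gen_least)
  show "{a + r * z |a r. a \<in> J} \<subseteq> ideal_gen (insert z J)"
  proof clarify
    fix a r assume "a \<in> J"
    then have "a \<in> ideal_gen (insert z J)" "z \<in> ideal_gen (insert z J)"
      using ideal_gen_superset[of "insert z J"] by auto
    then show "a + r * z \<in> ideal_gen (insert z J)"
      by (meson is_idealD(2,3) is_ideal_ideal_gen)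
  qed
qed

section \<open>Prime avoidance\<close>

lemma is_prime_ideal_prod:
  assumes "is_prime_ideal P" "\<And>x. x \<in> A \<Longrightarrow> f x \<notin> P"
  shows "prod f A \<notin> P"
  using assms by (induction A rule: infinite_finite_induct) (auto simp: is_prime_ideal_def)

text \<open>Otherwise, multiplying elements of each \<open>Q\<close> outside \<open>P\<close> gives
  an element of the intersection outside \<open>P\<close>; for empty \<open>F\<close> it is
  1.\<close>

lemma prime_ideal_Inter_subset:
  assumes P: "is_prime_ideal P" and F: "finite F" "\<And>Q. Q \<in> F \<Longrightarrow> is_ideal Q"
    and sub: "\<Inter>F \<subseteq> P"
  shows "\<exists>Q\<in>F. Q \<subseteq> P"
proof (rule ccontr)
  assume "\<not> ?thesis"
  then have "\<forall>Q\<in>F. \<exists>x. x \<in> Q \<and> x \<notin> P" by blast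
  then obtain x where x: "\<And>Q. Q \<in> F \<Longrightarrow> x Q \<in> Q \<and> x Q \<notin> P" by metis
  have "prod x F \<in> \<Inter>F" using x F by (auto intro: is_ideal_prod)
  moreover have "prod x F \<notin> P" using x by (intro is_prime_ideal_prod[OF P]) auto
  ultimately show False using sub by blast
qed

text \<open>Induction over proper subfamilies reduces to an irredundant cover, where each
  \<open>P\<close> owns an element \<open>x P\<close> of \<open>I\<close> lying in no other
  member.\<close>

lemma prime_avoidance:
  assumes I: "is_ideal I" and F: "finite F" "\<And>P. P \<in> F \<Longrightarrow> is_prime_ideal P"
    and sub: "I \<subseteq> \<Union>F"
  shows "\<exists>P\<in>F. I \<subseteq> P"
  using F sub
proof (induction F rule: finite_psubset_induct)
  case (psubset F)
  show ?case
  proof (cases "\<exists>P\<in>F. I \<subseteq> \<Union>(F - {P})")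
    case True
    then obtain P where "P \<in> F" "I \<subseteq> \<Union>(F - {P})" by blast
    moreover from this have "F - {P} \<subset> F" by blast
    ultimately have "\<exists>P'\<in>F - {P}. I \<subseteq> P'"
      using psubset.prems(1) by (intro psubset.IH) auto
    then show ?thesis by blast
  next
    case False
    then have "\<exists>x. x \<in> I \<and> x \<notin> \<Union>(F - {P})" if "P \<in> F" for P
      using that by (simp only: subset_iff) metis
    then obtain x where "\<And>P. P \<in> F \<Longrightarrow> x P \<in> I \<and> x P \<notin> \<Union>(F - {P})" by metis
    then have x: "\<And>P. P \<in> F \<Longrightarrow> x P \<in> I \<and> (\<forall>Q\<in>F - {P}. x P \<notin> Q)" by simp
    have xP: "x P \<in> P" if PF: "P \<in> F" for P
    proof -
      obtain Q where "Q \<in> F" "x P \<in> Q"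
        using subsetD[OF psubset.prems(2), of "x P"] x[OF PF] by auto
      then show ?thesis using x[OF PF] by (cases "Q = P") auto
    qed
    obtain P where P: "P \<in> F"
      using subsetD[OF psubset.prems(2) is_idealD(1)[OF I]] by auto
    show ?thesis
    proof (cases "F = {P}")
      case True
      then show ?thesis using psubset.prems(2) by auto
    next
      case False
      then obtain Q where Q: "Q \<in> F - {P}" using P by blast
      \<comment> \<open>\<open>x P + y\<close> lies in \<open>I\<close> but in no member: modulo
        \<open>P\<close> it is \<open>y\<close>, a product of elements outside \<open>P\<close>;
        modulo any other member it is \<open>x P\<close>.\<close>
      define y where "y = prod x (F - {P})"
      have ideal: "is_ideal Q'" if "Q' \<in> F" for Q'
        using psubset.prems(1) that by (auto simp: is_prime_ideal_def)
      have fin: "finite (F - {P})" using psubset.hyps by simp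
      have "y \<in> I"
        unfolding y_def using x Q by (intro is_ideal_prod[OF I fin Q]) auto
      then have "x P + y \<in> I" using x[OF P] by (simp add: is_idealD(2)[OF I])
      then obtain Q' where Q': "Q' \<in> F" "x P + y \<in> Q'" using psubset.prems(2) by blast
      show ?thesis
      proof (cases "Q' = P")
        case True
        then have "y \<in> P" using is_ideal_diff[OF ideal[OF P] Q'(2)[unfolded True] xP[OF P]] by simp
        moreover have "y \<notin> P"
          unfolding y_def using x P by (intro is_prime_ideal_prod[OF psubset.prems(1)[OF P]]) auto
        ultimately show ?thesis by simp
      next
        case False
        then have "y \<in> Q'"
          unfolding y_def using Q' xP False by (intro is_ideal_prod[OF ideal fin, of Q' Q']) auto
        then have "x P \<in> Q'" using is_ideal_diff[OF ideal[OF Q'(1)] Q'(2)] by force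
        then show ?thesis using x[OF P] Q' False by blast
      qed
    qed
  qed
qed

text \<open>The larger ideal comes first, so well-foundedness of this relation is the ascending
  chain condition.\<close>

definition strict_superideals :: "('a::comm_ring_1 set \<times> 'a set) set" where
  "strict_superideals = {(K, J). is_ideal J \<and> is_ideal K \<and> J \<subset> K}"

lemma ex_maximal_ideal:
  assumes wf: "wf (strict_superideals :: ('a::comm_ring_1 set \<times> 'a set) set)"
    and ne: "S \<noteq> {}" and ideals: "\<And>J::'a set. J \<in> S \<Longrightarrow> is_ideal J"
  shows "\<exists>J\<in>S. \<forall>K\<in>S. J \<subseteq> K \<longrightarrow> K = J"
proof -
  obtain J0 where "J0 \<in> S" using ne by auto
  then have "\<exists>J\<in>S. \<forall>K. (K, J) \<in> strict_superideals \<longrightarrow> K \<notin> S"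
    using wf unfolding wf_eq_minimal by metis
  then obtain J where J: "J \<in> S" "\<And>K. (K, J) \<in> strict_superideals \<Longrightarrow> K \<notin> S"
    by metis
  have "K = J" if "K \<in> S" "J \<subseteq> K" for K
  proof (rule ccontr)
    assume "K \<noteq> J"
    then have "(K, J) \<in> strict_superideals"
      using that ideals[OF J(1)] ideals[OF that(1)] by (simp add: strict_superideals_def psubset_eq)
    then show False using J(2) that(1) by metis
  qed
  then show ?thesis using J(1) by metis
qed

section \<open>Annihilators and zero divisors modulo an ideal\<close>

definition colon :: "'a::comm_ring_1 set \<Rightarrow> 'a \<Rightarrow> 'a set" where
  "colon J u = {r. r * u \<in> J}"

lemma is_ideal_colon: "is_ideal J \<Longrightarrow> is_ideal (colon J u)"
  unfolding colon_def is_ideal_def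
  by (auto simp: algebra_simps)

text \<open>In a Noetherian ring these are the inclusion-maximal associated primes of
  \<open>R/J\<close>; together they cover all zero divisors.\<close>

definition maximal_annihilators :: "'a::comm_ring_1 set \<Rightarrow> 'a set set" where
  "maximal_annihilators J =
     {P. \<exists>u. u \<notin> J \<and> P = colon J u \<and> (\<forall>v. v \<notin> J \<longrightarrow> P \<subseteq> colon J v \<longrightarrow> colon J v = P)}"

text \<open>If \<open>a * b\<close> kills \<open>u\<close> modulo \<open>J\<close> but
  \<open>b\<close> does not, the annihilator of \<open>b * u\<close> contains \<open>P\<close>,
  equals it by maximality, and contains \<open>a\<close>.\<close>

lemma maximal_annihilators_prime:
  assumes J: "is_ideal J" and P: "P \<in> maximal_annihilators J"
  shows "is_prime_ideal P"
proof -
  obtain u where u: "u \<notin> J" "P = colon J u"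
    and max: "\<And>v. v \<notin> J \<Longrightarrow> P \<subseteq> colon J v \<Longrightarrow> colon J v = P"
    using P by (auto simp: maximal_annihilators_def)
  have "a \<in> P" if "a * b \<in> P" "b \<notin> P" for a b
  proof -
    have "P \<subseteq> colon J (b * u)"
      using is_idealD(3)[OF J, of _ b] u by (auto simp: colon_def mult.left_commute[of _ b])
    then have "colon J (b * u) = P" using max that u by (auto simp: colon_def)
    then show ?thesis using that u by (auto simp: colon_def mult.assoc)
  qed
  then show ?thesis
    using u is_ideal_colon[OF J] by (auto simp: is_prime_ideal_def colon_def)
qed

text \<open>A maximal element among the annihilators containing \<open>colon J u\<close> is maximal
  among all annihilators, and \<open>colon J u\<close> contains \<open>z\<close>.\<close>

lemma zero_divisor_in_maximal_annihilator:
  assumes wf: "wf (strict_superideals :: ('a::comm_ring_1 set \<times> 'a set) set)"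
    and J: "is_ideal (J :: 'a set)" and "u \<notin> J" "u * z \<in> J"
  shows "\<exists>P\<in>maximal_annihilators J. z \<in> P"
proof -
  let ?S = "{colon J v |v. v \<notin> J \<and> colon J u \<subseteq> colon J v}"
  have "colon J u \<in> ?S" using assms(3) by auto
  then have "?S \<noteq> {}" by (metis empty_iff)
  then have "\<exists>K\<in>?S. \<forall>K'\<in>?S. K \<subseteq> K' \<longrightarrow> K' = K"
    by (rule ex_maximal_ideal[OF wf]) (auto simp: is_ideal_colon[OF J])
  then obtain v where v: "v \<notin> J" "colon J u \<subseteq> colon J v"
    and max: "\<And>K. K \<in> ?S \<Longrightarrow> colon J v \<subseteq> K \<Longrightarrow> K = colon J v"
    by auto
  have "colon J v' = colon J v" if "v' \<notin> J" "colon J v \<subseteq> colon J v'" for v'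
    using that v by (intro max) auto
  then have "colon J v \<in> maximal_annihilators J"
    using v(1) by (auto simp: maximal_annihilators_def)
  moreover have "z \<in> colon J v"
    using v(2) assms(4) by (auto simp: colon_def mult.commute)
  ultimately show ?thesis by blast
qed

text \<open>By the ascending chain condition, finitely many of the annihilated elements generate all of
  them modulo \<open>J\<close>; a maximal annihilator then contains the intersection of finitely many of the
  others, hence equals one of them.\<close>

lemma finite_maximal_annihilators:
  assumes wf: "wf (strict_superideals :: ('a::comm_ring_1 set \<times> 'a set) set)"
    and J: "is_ideal (J :: 'a set)"
  shows "finite (maximal_annihilators J)"
proof -
  let ?M = "maximal_annihilators J"
  have "\<forall>P\<in>?M. \<exists>u. u \<notin> J \<and> P = colon J u"
    by (auto simp: maximal_annihilators_def)
  then obtain u where u: "\<And>P. P \<in> ?M \<Longrightarrow> u P \<notin> J \<and> P = colon J (u P)" by metis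
  have max: "P = Q" if "P \<in> ?M" "Q \<in> ?M" "Q \<subseteq> P" for P Q
    using that u[OF that(1)] unfolding maximal_annihilators_def by blast
  let ?S = "{ideal_gen (J \<union> u ` F) |F. finite F \<and> F \<subseteq> ?M}"
  have "?S \<noteq> {}" by blast
  then obtain K where K: "K \<in> ?S" "\<forall>K'\<in>?S. K \<subseteq> K' \<longrightarrow> K' = K"
    using ex_maximal_ideal[OF wf, of ?S] is_ideal_ideal_gen by blast
  then obtain F where F: "finite F" "F \<subseteq> ?M" "K = ideal_gen (J \<union> u ` F)" by blast
  have "?M \<subseteq> F"
  proof
    fix P assume P: "P \<in> ?M"
    have "ideal_gen (J \<union> u ` insert P F) = K"
      using K(2) F P ideal_gen_mono[of "J \<union> u ` F" "J \<union> u ` insert P F"] by blast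
    then have uP: "u P \<in> K" using ideal_gen_superset[of "J \<union> u ` insert P F"] by auto
    have "\<Inter>F \<subseteq> P"
    proof
      fix r assume r: "r \<in> \<Inter>F"
      have "r * u Q \<in> J" if "Q \<in> F" for Q
      proof -
        have "r \<in> colon J (u Q)" using r that u[of Q] F(2) by blast
        then show ?thesis by (simp add: colon_def)
      qed
      then have "J \<union> u ` F \<subseteq> colon J r"
        using is_idealD(4)[OF J] by (auto simp: colon_def mult.commute)
      then have "K \<subseteq> colon J r" using F(3) ideal_gen_least is_ideal_colon[OF J] by blast
      then have "r * u P \<in> J" using uP by (auto simp: colon_def mult.commute)
      then show "r \<in> P" using u[OF P] by (auto simp: colon_def)
    qed
    then obtain Q where "Q \<in> F" "Q \<subseteq> P"
      using prime_ideal_Inter_subset[OF maximal_annihilators_prime[OF J P] F(1)] F(2)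
        maximal_annihilators_prime[OF J] by (auto simp: is_prime_ideal_def)
    then show "P \<in> F" using max P F(2) by blast
  qed
  then show ?thesis using F(1) finite_subset by blast
qed

section \<open>Exchanging regular sequences\<close>

text \<open>Recursive form of regularity, suited to induction over the sequence. \<open>T\<close>
  records where the entries come from; properness is left out and restored at the end.\<close>

fun reg :: "'a::comm_ring_1 set \<Rightarrow> 'a set \<Rightarrow> 'a list \<Rightarrow> bool" where
  "reg T J [] \<longleftrightarrow> True"
| "reg T J (f # fs) \<longleftrightarrow> f \<in> T \<and> (\<forall>g. g * f \<in> J \<longrightarrow> g \<in> J) \<and> reg T (ideal_gen (insert f J)) fs"

lemma reg_iff:
  assumes "is_ideal J"
  shows "reg T J fs \<longleftrightarrow> set fs \<subseteq> T \<and>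
     (\<forall>i<length fs. \<forall>g. g * fs ! i \<in> ideal_gen (J \<union> set (take i fs))
                          \<longrightarrow> g \<in> ideal_gen (J \<union> set (take i fs)))"
  using assms
proof (induction fs arbitrary: J)
  case Nil
  show ?case by simp
next
  case (Cons f fs)
  have "ideal_gen (ideal_gen (insert f J) \<union> A) = ideal_gen (J \<union> insert f A)" for A
    using ideal_gen_Un_ideal_gen[of A "insert f J"] by (simp add: Un_commute)
  then show ?case
    using Cons.IH[OF is_ideal_ideal_gen, of "insert f J"] Cons.prems
    by (auto simp: ideal_gen_ideal All_less_Suc2)
qed

text \<open>The ideal generated by \<open>J\<close> and the whole list is left out, since regularity
  provides a nonzerodivisor only modulo the proper prefixes.\<close>

fun prefix_ideals :: "'a::comm_ring_1 set \<Rightarrow> 'a list \<Rightarrow> 'a set list" where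
  "prefix_ideals J [] = []"
| "prefix_ideals J (f # fs) = J # prefix_ideals (ideal_gen (insert f J)) fs"

lemma is_ideal_prefix_ideals:
  assumes "is_ideal J" "Q \<in> set (prefix_ideals J fs)"
  shows "is_ideal Q"
  using assms
proof (induction fs arbitrary: J)
  case (Cons f fs)
  then show ?case using Cons.IH[OF is_ideal_ideal_gen] by (cases "Q = J") simp_all
qed simp

text \<open>The witness is the entry that follows the prefix.\<close>

lemma prefix_ideals_nonzerodivisor:
  assumes "reg T J fs" "Q \<in> set (prefix_ideals J fs)"
  shows "\<exists>f\<in>T. \<forall>g. g * f \<in> Q \<longrightarrow> g \<in> Q"
  using assms
proof (induction fs arbitrary: J)
  case (Cons f fs)
  show ?case
  proof (cases "Q = J")
    case True
    then show ?thesis using Cons.prems(1) by (intro bexI[of _ f]) simp_all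
  next
    case False
    then show ?thesis using Cons.prems by (intro Cons.IH[of "ideal_gen (insert f J)"]) simp_all
  qed
qed simp

text \<open>Regularity of \<open>f\<close> after adjoining \<open>z\<close> is deduced from
  regularity of \<open>z\<close> modulo the prefix ending in \<open>f\<close>. For the last entry
  that prefix is not proper, so the last entry is dropped.\<close>

lemma reg_swap:
  assumes "is_ideal J" "reg T J fs"
    and "\<And>Q g. Q \<in> set (prefix_ideals J fs) \<Longrightarrow> g * z \<in> Q \<Longrightarrow> g \<in> Q"
  shows "reg T (ideal_gen (insert z J)) (butlast fs)"
  using assms
proof (induction fs arbitrary: J)
  case Nil
  show ?case by simp
next
  case (Cons f fs)
  show ?case
  proof (cases fs)
    case Nil
    then show ?thesis by simp
  next
    case (Cons f' fs')
    have J: "is_ideal J" by fact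
    let ?Jf = "ideal_gen (insert f J)" and ?Jz = "ideal_gen (insert z J)"
    have f: "f \<in> T" "\<And>g. g * f \<in> J \<Longrightarrow> g \<in> J" using Cons.prems(2) by auto
    \<comment> \<open>\<open>?Jf\<close> is among the prefix ideals because the tail
      \<open>fs\<close> is nonempty in this case.\<close>
    have zf: "g \<in> ?Jf" if "g * z \<in> ?Jf" for g
      using Cons.prems(3)[of ?Jf g] that Cons by simp
    have "g \<in> ?Jz" if g: "g * f \<in> ?Jz" for g
    proof -
      obtain a b where a: "a \<in> J" "g * f = a + b * z"
        using g by (auto simp: ideal_gen_insert_ideal[OF J])
      then have "b * z = - a + g * f" by simp
      then have "b * z \<in> ?Jf"
        using is_ideal_uminus[OF J a(1)] unfolding ideal_gen_insert_ideal[OF J] by blast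
      then have "b \<in> ?Jf" by (rule zf)
      then obtain c e where c: "c \<in> J" "b = c + e * f"
        by (auto simp: ideal_gen_insert_ideal[OF J])
      \<comment> \<open>Substituting \<open>b = c + e * f\<close> moves the \<open>f\<close>-part of
        \<open>b * z\<close> to the left, so \<open>f\<close> can be cancelled modulo
        \<open>J\<close>.\<close>
      have "(g - e * z) * f = a + c * z" using a(2) c(2) by (simp add: algebra_simps)
      also have "\<dots> \<in> J" using a c J is_idealD by blast
      finally have "g - e * z \<in> J" by (rule f)
      moreover have "g = (g - e * z) + e * z" by simp
      ultimately show ?thesis unfolding ideal_gen_insert_ideal[OF J] by blast
    qed
    moreover have "reg T (ideal_gen (insert z ?Jf)) (butlast fs)"
      using Cons.IH[OF is_ideal_ideal_gen, of "insert f J"] Cons.prems by auto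
    \<comment> \<open>Swapping the two adjoined elements turns the induction hypothesis into the
      tail condition of \<open>reg\<close>.\<close>
    moreover have "ideal_gen (insert z ?Jf) = ideal_gen (insert f ?Jz)"
      using ideal_gen_Un_ideal_gen[of "{z}" "insert f J"] ideal_gen_Un_ideal_gen[of "{f}" "insert z J"]
      by (simp add: insert_commute)
    ultimately show ?thesis using f Cons by simp
  qed
qed

text \<open>Contrapositively: if each of finitely many \<open>R/Q\<close> has a nonzerodivisor in
  \<open>M\<close>, a single element of \<open>T\<close> is a nonzerodivisor on all of them.\<close>

definition avoids :: "'a::comm_ring_1 set \<Rightarrow> 'a set \<Rightarrow> bool" where
  "avoids T M \<longleftrightarrow> (\<forall>\<Q>. finite \<Q> \<longrightarrow> (\<forall>Q\<in>\<Q>. is_ideal Q) \<longrightarrow>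
     (\<forall>z\<in>T. \<exists>Q\<in>\<Q>. \<exists>u. u \<notin> Q \<and> u * z \<in> Q) \<longrightarrow>
     (\<exists>Q\<in>\<Q>. \<exists>u. u \<notin> Q \<and> (\<forall>f\<in>M. u * f \<in> Q)))"

text \<open>Each round gains one element of \<open>T\<close> in front and loses the last entry, so
  the length is kept.\<close>

lemma reg_exchange:
  assumes "avoids T M" "is_ideal J" "reg M J fs"
  shows "\<exists>ts. length ts = length fs \<and> reg T J ts"
  using assms(2,3)
proof (induction "length fs" arbitrary: fs J)
  case 0
  then show ?case by auto
next
  case (Suc d)
  have J: "is_ideal J" by fact
  let ?\<Q> = "set (prefix_ideals J fs)"
  have "\<not> (\<exists>Q\<in>?\<Q>. \<exists>u. u \<notin> Q \<and> (\<forall>f\<in>M. u * f \<in> Q))"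
    using prefix_ideals_nonzerodivisor[OF Suc.prems(2)] by blast
  then have "\<not> (\<forall>z\<in>T. \<exists>Q\<in>?\<Q>. \<exists>u. u \<notin> Q \<and> u * z \<in> Q)"
    using assms(1) is_ideal_prefix_ideals[OF J] unfolding avoids_def by blast
  then obtain z where z: "z \<in> T" "\<And>Q u. Q \<in> ?\<Q> \<Longrightarrow> u * z \<in> Q \<Longrightarrow> u \<in> Q" by blast
  have "reg M (ideal_gen (insert z J)) (butlast fs)"
    using reg_swap[OF J Suc.prems(2)] z by blast
  moreover have "d = length (butlast fs)" using Suc.hyps(2) by simp
  ultimately obtain ts where "length ts = d" "reg T (ideal_gen (insert z J)) ts"
    using Suc.hyps(1) is_ideal_ideal_gen by metis
  \<comment> \<open>As \<open>fs\<close> is nonempty, \<open>J\<close> is itself a prefix ideal, so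
    \<open>z\<close> is regular modulo \<open>J\<close>.\<close>
  moreover have "J \<in> ?\<Q>" using Suc.hyps(2) by (cases fs) auto
  ultimately show ?case
    using z Suc.hyps(2) by (intro exI[of _ "z # ts"]) auto
qed

text \<open>Prime avoidance takes place in the domain of \<open>\<phi>\<close>, where the preimages of the associated primes
  are again prime.\<close>

lemma avoids_image:
  fixes \<phi> :: "'a::comm_ring_1 \<Rightarrow> 'b::comm_ring_1"
  assumes wf: "wf (strict_superideals :: ('b set \<times> 'b set) set)"
    and hom: "\<phi> 0 = 0" "\<phi> 1 = 1" "\<And>x y. \<phi> (x + y) = \<phi> x + \<phi> y" "\<And>x y. \<phi> (x * y) = \<phi> x * \<phi> y"
    and I: "is_ideal I" and rad: "\<And>P. is_prime_ideal P \<Longrightarrow> \<phi> ` I \<subseteq> P \<Longrightarrow> M \<subseteq> P"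
  shows "avoids (\<phi> ` I) M"
  unfolding avoids_def
proof (intro allI impI)
  fix \<Q> :: "'b set set"
  assume \<Q>: "finite \<Q>" "\<forall>Q\<in>\<Q>. is_ideal Q"
    and zd: "\<forall>z\<in>\<phi> ` I. \<exists>Q\<in>\<Q>. \<exists>u. u \<notin> Q \<and> u * z \<in> Q"
  define \<P> where "\<P> = (\<Union>Q\<in>\<Q>. maximal_annihilators Q)"
  have fin: "finite \<P>" and prime: "\<And>P. P \<in> \<P> \<Longrightarrow> is_prime_ideal P"
    using \<Q> finite_maximal_annihilators[OF wf] maximal_annihilators_prime
    by (auto simp: \<P>_def)
  have "is_prime_ideal (\<phi> -` P)" if "P \<in> \<P>" for P
    using prime[OF that] hom by (auto simp: is_prime_ideal_def is_ideal_def)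
  moreover have "I \<subseteq> \<Union>((-`) \<phi> ` \<P>)"
  proof
    fix h assume "h \<in> I"
    then obtain Q u where "Q \<in> \<Q>" "u \<notin> Q" "u * \<phi> h \<in> Q" using zd by blast
    then obtain P where "P \<in> maximal_annihilators Q" "\<phi> h \<in> P"
      using zero_divisor_in_maximal_annihilator[OF wf] \<Q> by blast
    then show "h \<in> \<Union>((-`) \<phi> ` \<P>)" using \<open>Q \<in> \<Q>\<close> by (auto simp: \<P>_def)
  qed
  ultimately obtain P where P: "P \<in> \<P>" "I \<subseteq> \<phi> -` P"
    using prime_avoidance[OF I, of "(-`) \<phi> ` \<P>"] fin by auto
  then have "M \<subseteq> P" using rad prime by blast
  moreover obtain Q u where "Q \<in> \<Q>" "u \<notin> Q" "P = colon Q u"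
    using P(1) by (auto simp: \<P>_def maximal_annihilators_def)
  ultimately show "\<exists>Q\<in>\<Q>. \<exists>u. u \<notin> Q \<and> (\<forall>f\<in>M. u * f \<in> Q)"
    by (intro bexI[of _ Q] exI[of _ u]) (auto simp: colon_def mult.commute)
qed

section \<open>Monomials\<close>

abbreviation "lookup \<equiv> Poly_Mapping.lookup"
abbreviation "keys \<equiv> Poly_Mapping.keys"
abbreviation "single \<equiv> Poly_Mapping.single"

lemma poly_mapping_eq_sum_single:
  fixes f :: "'a \<Rightarrow>\<^sub>0 'b::comm_monoid_add"
  shows "(\<Sum>a\<in>keys f. single a (lookup f a)) = f"
proof (rule poly_mapping_eqI)
  fix k
  have "(\<Sum>a\<in>keys f. lookup (single a (lookup f a)) k)
      = (\<Sum>a\<in>keys f. if a = k then lookup f a else 0)"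
    by (intro sum.cong) (auto simp: lookup_single when_def)
  also have "\<dots> = lookup f k" by (simp add: in_keys_iff)
  finally show "lookup (\<Sum>a\<in>keys f. single a (lookup f a)) k = lookup f k"
    by (simp add: lookup_sum)
qed

lemma poly_mapping_add_induct [case_names zero single add]:
  fixes f :: "'a \<Rightarrow>\<^sub>0 'b::comm_monoid_add"
  assumes "P 0" "\<And>a c. P (single a c)" "\<And>f g. P f \<Longrightarrow> P g \<Longrightarrow> P (f + g)"
  shows "P f"
proof -
  have "P (\<Sum>a\<in>A. single a (lookup f a))" for A
    by (induction A rule: infinite_finite_induct) (simp_all add: assms)
  from this[of "keys f"] show ?thesis by (simp only: poly_mapping_eq_sum_single)
qed

text \<open>An exponent that splits in only one way admits no cancellation. \<open>a0\<close> or
  \<open>b0\<close> may lie outside the support; both sides are then 0.\<close>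

lemma lookup_mult_unique:
  fixes f g :: "'a::comm_monoid_add \<Rightarrow>\<^sub>0 'b::comm_ring_1"
  assumes "\<And>a b. a \<in> keys f \<Longrightarrow> b \<in> keys g \<Longrightarrow> a + b = a0 + b0 \<Longrightarrow> a = a0 \<and> b = b0"
  shows "lookup (f * g) (a0 + b0) = lookup f a0 * lookup g b0"
proof -
  have "f * g = (\<Sum>a\<in>keys f. single a (lookup f a)) * (\<Sum>b\<in>keys g. single b (lookup g b))"
    by (simp only: poly_mapping_eq_sum_single)
  also have "\<dots> = (\<Sum>a\<in>keys f. \<Sum>b\<in>keys g. single (a + b) (lookup f a * lookup g b))"
    by (simp only: sum_product mult_single)
  finally have "lookup (f * g) (a0 + b0) = (\<Sum>a\<in>keys f. \<Sum>b\<in>keys g.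
      lookup f a * lookup g b when a + b = a0 + b0)"
    by (simp add: lookup_sum lookup_single)
  also have "\<dots> = (\<Sum>a\<in>keys f. \<Sum>b\<in>keys g.
      if b = b0 then (if a = a0 then lookup f a0 * lookup g b0 else 0) else 0)"
    using assms by (intro sum.cong refl) (auto simp: when_def)
  also have "\<dots> = (\<Sum>a\<in>keys f. if a = a0 then lookup f a0 * lookup g b0 else 0)"
    by (intro sum.cong refl) (auto simp: in_keys_iff)
  also have "\<dots> = lookup f a0 * lookup g b0"
    by (auto simp: in_keys_iff)
  finally show ?thesis .
qed

lemma lookup_monom_mult: "lookup (monom b * f) (b + a) = lookup f (a :: 'v \<Rightarrow>\<^sub>0 nat)"
  by (subst lookup_mult_unique) (auto simp: monom_def)

lemma lookup_const_mult:
  "lookup (single 0 (c :: 'k::comm_ring_1) * f) (a :: 'v \<Rightarrow>\<^sub>0 nat) = c * lookup f a"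
proof -
  have "lookup (single 0 c * f) (0 + a) = lookup (single (0 :: 'v \<Rightarrow>\<^sub>0 nat) c) 0 * lookup f a"
    by (rule lookup_mult_unique[of "single 0 c" f 0 a]) (simp split: if_splits)
  then show ?thesis by simp
qed

lemma monom_0: "monom 0 = 1"
  by (simp add: monom_def)

lemma monom_add: "monom (a + b) = monom a * monom b"
  by (simp add: monom_def mult_single)

lemma single_eq_const_mult_monom: "single a c = single 0 c * monom a"
  by (simp add: monom_def mult_single)

lemma add_diff_le:
  fixes a b :: "'v \<Rightarrow>\<^sub>0 nat"
  assumes "\<And>v. lookup b v \<le> lookup a v"
  shows "b + (a - b) = a"
  by (rule poly_mapping_eqI) (simp add: lookup_add lookup_minus assms)

lemma monom_decompose_var:
  assumes "lookup a v \<noteq> 0"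
  shows "single v 1 + (a - single v 1) = (a :: 'v \<Rightarrow>\<^sub>0 nat)"
    and "monom a = var v * monom (a - single v 1)"
proof -
  show *: "single v 1 + (a - single v 1) = (a :: 'v \<Rightarrow>\<^sub>0 nat)"
    using assms by (intro add_diff_le) (auto simp: lookup_single when_def)
  show "monom a = var v * monom (a - single v 1)"
    by (simp only: var_def monom_add[symmetric] *)
qed

definition deg_on :: "'v::finite set \<Rightarrow> ('v \<Rightarrow>\<^sub>0 nat) \<Rightarrow> nat" where
  "deg_on F a = (\<Sum>v\<in>F. lookup a v)"

lemma deg_on_add: "deg_on F (a + b) = deg_on F a + deg_on F b"
  by (simp add: deg_on_def lookup_add sum.distrib)

lemma deg_on_0 [simp]: "deg_on F 0 = 0"
  by (simp add: deg_on_def)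

lemma deg_on_single: "deg_on F (single v n) = (if v \<in> F then n else 0)"
  by (simp add: deg_on_def lookup_single when_def)

section \<open>The polynomial ring is Noetherian\<close>

text \<open>Encoding \<open>x\<^sup>a\<close> as the positive integer with prime exponents \<open>a\<close> gives a monomial well-order.\<close>

definition var_prime :: "'v::finite \<Rightarrow> nat" where
  "var_prime = (SOME p. inj p \<and> (\<forall>v. prime (p v)))"

definition mon_code :: "('v::finite \<Rightarrow>\<^sub>0 nat) \<Rightarrow> nat" where
  "mon_code a = (\<Prod>v\<in>UNIV. var_prime v ^ lookup a v)"

lemma var_prime: "inj (var_prime :: 'v::finite \<Rightarrow> nat)" "prime (var_prime (v :: 'v))"
proof -
  let ?A = "{p::nat. prime p}"
  obtain f :: "'v \<Rightarrow> nat" where "inj f"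
    using finite_imp_inj_to_nat_seg[of "UNIV :: 'v set"] by auto
  moreover have "infinite ?A" by (rule primes_infinite)
  ultimately have "inj (enumerate ?A \<circ> f)" "\<forall>v. prime ((enumerate ?A \<circ> f) v)"
    using strict_mono_imp_inj_on[OF strict_mono_enumerate] enumerate_in_set[of ?A]
    by (auto intro: inj_compose)
  then have "\<exists>p :: 'v \<Rightarrow> nat. inj p \<and> (\<forall>v. prime (p v))" by blast
  then have "inj (var_prime :: 'v \<Rightarrow> nat) \<and> (\<forall>v::'v. prime (var_prime v))"
    unfolding var_prime_def by (rule someI_ex)
  then show "inj (var_prime :: 'v \<Rightarrow> nat)" "prime (var_prime (v :: 'v))" by auto
qed

lemma mon_code_add: "mon_code (a + b) = mon_code a * mon_code b"
  by (simp add: mon_code_def lookup_add power_add prod.distrib)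

lemma mon_code_pos: "mon_code a > 0"
  unfolding mon_code_def using var_prime(2) by (auto intro!: prod_pos prime_gt_0_nat)

text \<open>Unique factorization: exponents are read back as prime multiplicities.\<close>

lemma mon_code_inject: "mon_code a = mon_code b \<longleftrightarrow> a = b"
proof
  assume eq: "mon_code a = mon_code b"
  have "multiplicity (var_prime v) (mon_code c) = lookup c v" for v :: 'a and c
  proof -
    let ?g = "\<lambda>p. lookup c (inv var_prime p)"
    have "mon_code c = (\<Prod>p\<in>range (var_prime :: 'a \<Rightarrow> nat). p ^ ?g p)"
      by (simp add: mon_code_def prod.reindex[OF var_prime(1)] inv_f_f[OF var_prime(1)])
    also have "multiplicity (var_prime v) \<dots> =
        (if var_prime v \<in> range (var_prime :: 'a \<Rightarrow> nat) then ?g (var_prime v) else 0)"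
      using var_prime(2) by (intro multiplicity_prod_prime_powers) auto
    finally show ?thesis by (simp add: inv_f_f[OF var_prime(1)])
  qed
  then show "a = b" using eq by (metis poly_mapping_eqI)
qed simp

section \<open>Leading monomials and division\<close>

definition is_lead :: "('v::finite, 'k::field) mpoly \<Rightarrow> ('v \<Rightarrow>\<^sub>0 nat) \<Rightarrow> bool" where
  "is_lead f a \<longleftrightarrow> a \<in> keys f \<and> (\<forall>b\<in>keys f. mon_code b \<le> mon_code a)"

lemma ex_lead:
  assumes "f \<noteq> 0"
  shows "\<exists>a. is_lead f a"
proof -
  have "keys f \<noteq> {}" using assms poly_mapping_eq_sum_single[of f] by auto
  then have "Max (mon_code ` keys f) \<in> mon_code ` keys f"
    by (intro Max_in) auto
  then obtain a where "a \<in> keys f" "mon_code a = Max (mon_code ` keys f)" by auto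
  then show ?thesis by (auto simp: is_lead_def)
qed

lemma is_lead_monom_mult:
  assumes "is_lead f a"
  shows "is_lead (monom b * f) (b + a)"
  unfolding is_lead_def
proof (intro conjI ballI)
  show "b + a \<in> keys (monom b * f)"
    using assms by (simp add: in_keys_iff lookup_monom_mult is_lead_def)
  fix c assume "c \<in> keys (monom b * f)"
  then obtain d where "d \<in> keys f" "c = b + d"
    using keys_mult[of "monom b" f] by (auto simp: monom_def split: if_splits)
  then show "mon_code c \<le> mon_code (b + a)"
    using assms by (simp add: is_lead_def mon_code_add)
qed

text \<open>Division by leading terms: subtracting a scalar multiple of \<open>g\<close> cancels the
  leading term of \<open>f\<close> and stays in \<open>K\<close>, while the largest code
  drops.\<close>

lemma ideal_subset_by_leads:
  fixes J K :: "('v::finite, 'k::field) mpoly set"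
  assumes J: "is_ideal J" and K: "is_ideal K" and "J \<subseteq> K"
    and leads: "\<And>f a. f \<in> K \<Longrightarrow> is_lead f a \<Longrightarrow> \<exists>g\<in>J. is_lead g a"
  shows "K \<subseteq> J"
proof
  fix f assume "f \<in> K"
  \<comment> \<open>The strict bound \<open>n\<close> on all codes serves as the induction variable;
    at 0 the support is empty.\<close>
  moreover obtain n where "\<forall>a\<in>keys f. mon_code a < n"
    using finite_nat_set_iff_bounded[of "mon_code ` keys f"] by auto
  ultimately show "f \<in> J"
  proof (induction n arbitrary: f)
    case 0
    then have "keys f = {}" by auto
    then have "f = 0" using poly_mapping_eq_sum_single[of f] by simp
    then show ?case using is_idealD(1)[OF J] by simp
  next
    case (Suc n)
    show ?case
    proof (cases "f = 0")
      case True
      then show ?thesis using is_idealD(1)[OF J] by simp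
    next
      case False
      then obtain a where a: "is_lead f a" using ex_lead by blast
      then obtain g where g: "g \<in> J" "is_lead g a" using leads Suc.prems(1) by blast
      define r where "r = single 0 (lookup f a / lookup g a) * g"
      have r: "r \<in> J" unfolding r_def using J g(1) by (rule is_idealD)
      have lr: "lookup r b = lookup f a / lookup g a * lookup g b" for b
        by (simp add: r_def lookup_const_mult)
      have "f - r \<in> K" using is_ideal_diff[OF K Suc.prems(1)] r \<open>J \<subseteq> K\<close> by auto
      moreover have "mon_code b < n" if b: "b \<in> keys (f - r)" for b
      proof -
        have "b \<in> keys f \<or> b \<in> keys g"
          using b by (auto simp: in_keys_iff lookup_minus lr)
        then have "mon_code b \<le> mon_code a" using a g by (auto simp: is_lead_def)
        moreover have "b \<noteq> a"
          using b g(2) by (auto simp: in_keys_iff lookup_minus lr is_lead_def)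
        moreover have "mon_code a \<le> n"
          using Suc.prems(2) a by (auto simp: is_lead_def)
        moreover from this have "mon_code b \<noteq> mon_code a"
          using \<open>b \<noteq> a\<close> by (simp add: mon_code_inject)
        ultimately show ?thesis by linarith
      qed
      ultimately have "f - r \<in> J" using Suc.IH by blast
      then have "f - r + r \<in> J" using r J by (intro is_idealD(2))
      then show ?thesis by simp
    qed
  qed
qed

section \<open>Dickson's lemma and the basis theorem\<close>

lemma nat_seq_mono_subseq: "\<exists>r :: nat \<Rightarrow> nat. strict_mono r \<and> mono (\<lambda>n. (s :: nat \<Rightarrow> nat) (r n))"
proof -
  obtain f :: "nat \<Rightarrow> nat" where f: "strict_mono f" "monoseq (\<lambda>n. s (f n))"
    using seq_monosub by metis
  show ?thesis
  proof (cases "mono (\<lambda>n. s (f n))")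
    case True
    then show ?thesis using f(1) by (intro exI[of _ f]) simp
  next
    case False
    then have dec: "decseq (\<lambda>n. s (f n))"
      using f(2) by (auto simp: monoseq_iff)
    \<comment> \<open>A decreasing sequence of naturals is constant from an index \<open>k\<close>
      where its least value is attained.\<close>
    obtain k where k: "\<And>n. s (f k) \<le> s (f n)"
      using ex_has_least_nat[of "\<lambda>_. True" 0 "\<lambda>n. s (f n)"] by auto
    have "s (f (k + n)) = s (f k)" for n
      using k decseqD[OF dec, of k "k + n"] by (simp add: le_antisym)
    then have "mono (\<lambda>n. s (f (k + n)))" by (simp add: mono_def)
    moreover have "strict_mono (\<lambda>n. f (k + n))" using f(1) by (simp add: strict_mono_def)
    ultimately show ?thesis by (intro exI[of _ "\<lambda>n. f (k + n)"]) simp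
  qed
qed

text \<open>Subsequences are refined one variable at a time; thinning out preserves the monotonicity
  already reached.\<close>

lemma dickson_subseq:
  fixes x :: "nat \<Rightarrow> 'v \<Rightarrow> nat"
  assumes "finite V"
  shows "\<exists>r :: nat \<Rightarrow> nat. strict_mono r \<and> (\<forall>v\<in>V. mono (\<lambda>n. x (r n) v))"
  using assms
proof (induction V)
  case empty
  then show ?case by (intro exI[of _ id]) (simp add: strict_mono_def)
next
  case (insert v V)
  then obtain r :: "nat \<Rightarrow> nat" where r: "strict_mono r" "\<forall>v\<in>V. mono (\<lambda>n. x (r n) v)" by blast
  obtain q :: "nat \<Rightarrow> nat" where q: "strict_mono q" "mono (\<lambda>n. x (r (q n)) v)"
    using nat_seq_mono_subseq[of "\<lambda>n. x (r n) v"] by metis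
  have "strict_mono (\<lambda>n. r (q n))" using r(1) q(1) by (simp add: strict_mono_def)
  moreover have "mono (\<lambda>n. x (r (q n)) w)" if "w \<in> insert v V" for w
  proof (cases "w = v")
    case False
    then have "mono (\<lambda>n. x (r n) w)" using r that by simp
    then show ?thesis using strict_mono_mono[OF q(1)] by (simp add: mono_def)
  qed (simp add: q)
  ultimately show ?case by (intro exI[of _ "\<lambda>n. r (q n)"]) simp
qed

lemma dickson:
  fixes x :: "nat \<Rightarrow> ('v::finite \<Rightarrow>\<^sub>0 nat)"
  shows "\<exists>i j. i < j \<and> (\<forall>v. lookup (x i) v \<le> lookup (x j) v)"
proof -
  obtain r :: "nat \<Rightarrow> nat" where r: "strict_mono r" "\<forall>v\<in>UNIV. mono (\<lambda>n. lookup (x (r n)) v)"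
    using dickson_subseq[of "UNIV :: 'v set" "\<lambda>n. lookup (x n)"] by auto
  then have "r 0 < r 1" "\<forall>v. lookup (x (r 0)) v \<le> lookup (x (r 1)) v"
    by (auto simp: strict_mono_def mono_def)
  then show ?thesis by blast
qed

text \<open>Hilbert's basis theorem. Every strict step of an ascending chain brings a new leading
  monomial; Dickson's lemma makes an earlier one, \<open>a i\<close>, divide a later one,
  \<open>a j\<close>.\<close>

lemma wf_strict_superideals_mpoly:
  "wf (strict_superideals :: (('v::finite, 'k::field) mpoly set \<times> _) set)"
proof -
  have False if chain: "\<And>n. (Q (Suc n), Q n) \<in> strict_superideals"
    for Q :: "nat \<Rightarrow> ('v, 'k) mpoly set"
  proof -
    have Q: "is_ideal (Q n)" "Q n \<subset> Q (Suc n)" for n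
      using chain[of n] by (auto simp: strict_superideals_def)
    have "\<exists>a. (\<exists>f\<in>Q (Suc n). is_lead f a) \<and> \<not> (\<exists>g\<in>Q n. is_lead g a)" for n
      using ideal_subset_by_leads[OF Q(1)[of n] Q(1)[of "Suc n"]] Q(2)[of n] by auto
    then obtain a where a: "\<And>n. \<exists>f\<in>Q (Suc n). is_lead f (a n)"
        "\<And>n. \<not> (\<exists>g\<in>Q n. is_lead g (a n))" by metis
    obtain i j where ij: "i < j" "\<And>v. lookup (a i) v \<le> lookup (a j) v"
      using dickson[of a] by metis
    obtain f where f: "f \<in> Q (Suc i)" "is_lead f (a i)" using a(1)[of i] by metis
    \<comment> \<open>As \<open>i < j\<close>, the element \<open>f\<close> with lead
      \<open>a i\<close> already lies in \<open>Q j\<close>, and so does its monomial multiple with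
      lead \<open>a j\<close>.\<close>
    have "Q (Suc i) \<subseteq> Q j"
      by (rule lift_Suc_mono_le[of Q]) (use ij(1) Q(2) in \<open>simp_all add: psubset_imp_subset\<close>)
    then have "monom (a j - a i) * f \<in> Q j" using f(1) by (intro is_idealD(3)[OF Q(1)]) (rule subsetD)
    moreover have "is_lead (monom (a j - a i) * f) (a j)"
      using is_lead_monom_mult[OF f(2), of "a j - a i"] add_diff_le[OF ij(2)] by (simp add: add.commute)
    ultimately show False using a(2)[of j] by metis
  qed
  then show ?thesis unfolding wf_iff_no_infinite_down_chain by metis
qed

section \<open>Symbolic powers of squarefree monomial ideals\<close>

text \<open>This is the \<open>t\<close>-th power of the prime generated by the variables in
  \<open>F\<close>, described by its monomials.\<close>

definition ord_ideal :: "'v::finite set \<Rightarrow> nat \<Rightarrow> ('v, 'k::field) mpoly set" where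
  "ord_ideal F t = {f. \<forall>a\<in>keys f. t \<le> deg_on F a}"

lemma ord_ideal_mult:
  assumes "f \<in> ord_ideal F s" "g \<in> ord_ideal F t"
  shows "f * g \<in> ord_ideal F (s + t)"
  unfolding ord_ideal_def
proof clarify
  fix c assume "c \<in> keys (f * g)"
  then obtain a b where "c = a + b" "a \<in> keys f" "b \<in> keys g" using keys_mult[of f g] by blast
  then show "s + t \<le> deg_on F c"
    using assms by (simp add: ord_ideal_def deg_on_add add_mono)
qed

lemma is_ideal_ord_ideal: "is_ideal (ord_ideal F t)"
  unfolding is_ideal_def
proof (intro conjI ballI allI)
  show "0 \<in> ord_ideal F t" by (simp add: ord_ideal_def)
next
  fix f g :: "('a, 'b) mpoly" assume "f \<in> ord_ideal F t" "g \<in> ord_ideal F t"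
  then show "f + g \<in> ord_ideal F t"
    using keys_add[of f g] by (auto simp: ord_ideal_def)
next
  fix r f :: "('a, 'b) mpoly" assume "f \<in> ord_ideal F t"
  moreover have "r \<in> ord_ideal F 0" by (simp add: ord_ideal_def)
  ultimately show "r * f \<in> ord_ideal F t" using ord_ideal_mult[of r F 0 f t] by simp
qed

lemma monom_in_ord_ideal_iff: "monom a \<in> ord_ideal F t \<longleftrightarrow> t \<le> deg_on F a"
  by (simp add: ord_ideal_def monom_def)

text \<open>The initial monomials of \<open>f\<close> and \<open>g\<close>, minimal first in \<open>F\<close>-degree and then in the
  monomial order, multiply to a monomial of \<open>g * f\<close>: the order along \<open>F\<close> is a valuation.\<close>

lemma ord_ideal_cancel:
  assumes g: "g \<notin> ord_ideal F 1" and gf: "g * f \<in> ord_ideal F t"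
  shows "f \<in> ord_ideal F t"
proof (rule ccontr)
  have init: "\<exists>a\<in>keys h. deg_on F a < n \<and>
      (\<forall>b\<in>keys h. deg_on F a < deg_on F b \<or>
        deg_on F a = deg_on F b \<and> mon_code a \<le> mon_code b)"
    if h: "h \<notin> ord_ideal F n" for h :: "('a, 'b) mpoly" and n
  proof -
    obtain c where c: "c \<in> keys h" "deg_on F c < n" using h by (auto simp: ord_ideal_def not_le)
    define d where "d = Min (deg_on F ` keys h)"
    have d: "d \<in> deg_on F ` keys h" and dle: "\<And>b. b \<in> keys h \<Longrightarrow> d \<le> deg_on F b"
      using c(1) by (auto simp: d_def intro: Min_in)
    define m where "m = Min (mon_code ` {a\<in>keys h. deg_on F a = d})"
    have "m \<in> mon_code ` {a\<in>keys h. deg_on F a = d}"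
      unfolding m_def using d by (intro Min_in) auto
    then obtain a where a: "a \<in> keys h" "deg_on F a = d" "mon_code a = m" by auto
    have "d < n" using c dle[OF c(1)] by simp
    moreover have "m \<le> mon_code b" if "b \<in> keys h" "deg_on F b = d" for b
      unfolding m_def using that by (intro Min_le) auto
    ultimately show ?thesis
      using a dle by (intro bexI[of _ a]) (auto simp: nat_less_le)
  qed
  assume "f \<notin> ord_ideal F t"
  then obtain b0 where b0: "b0 \<in> keys f" "deg_on F b0 < t"
    "\<And>b. b \<in> keys f \<Longrightarrow> deg_on F b0 < deg_on F b \<or>
        deg_on F b0 = deg_on F b \<and> mon_code b0 \<le> mon_code b"
    using init by metis
  obtain a0 where a0: "a0 \<in> keys g" "deg_on F a0 < 1"
    "\<And>a. a \<in> keys g \<Longrightarrow> deg_on F a0 < deg_on F a \<or>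
        deg_on F a0 = deg_on F a \<and> mon_code a0 \<le> mon_code a"
    using init[OF g] by metis
  have "lookup (g * f) (a0 + b0) = lookup g a0 * lookup f b0"
  proof (rule lookup_mult_unique)
    fix a b assume ab: "a \<in> keys g" "b \<in> keys f" "a + b = a0 + b0"
    \<comment> \<open>\<open>a0\<close> and \<open>b0\<close> have minimal degree, so equality of
      the sums forces equality termwise and the codes become comparable.\<close>
    have "deg_on F a + deg_on F b = deg_on F a0 + deg_on F b0"
      using arg_cong[OF ab(3), of "deg_on F"] by (simp only: deg_on_add)
    then have le: "mon_code a0 \<le> mon_code a" "mon_code b0 \<le> mon_code b"
      using a0(3)[OF ab(1)] b0(3)[OF ab(2)] by linarith+
    have eq: "mon_code a * mon_code b = mon_code a0 * mon_code b0"
      using arg_cong[OF ab(3), of mon_code] by (simp only: mon_code_add)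
    have "mon_code a = mon_code a0"
    proof (rule ccontr)
      assume "mon_code a \<noteq> mon_code a0"
      then have "mon_code a0 * mon_code b0 < mon_code a * mon_code b"
        using le mon_code_pos[of b0] by (intro mult_less_le_imp_less) auto
      then show False using eq by simp
    qed
    then have "a = a0" by (simp add: mon_code_inject)
    then show "a = a0 \<and> b = b0" using ab(3) by simp
  qed
  also have "\<dots> \<noteq> 0" using a0(1) b0(1) by (simp add: in_keys_iff)
  finally have "a0 + b0 \<in> keys (g * f)" by (simp add: in_keys_iff)
  then have "t \<le> deg_on F (a0 + b0)" using gf by (simp add: ord_ideal_def)
  then show False using a0(2) b0(2) by (simp add: deg_on_add)
qed

lemma is_prime_ideal_ord_ideal: "is_prime_ideal (ord_ideal F 1)"
  unfolding is_prime_ideal_def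
proof (intro conjI allI impI)
  show "is_ideal (ord_ideal F 1)" by (rule is_ideal_ord_ideal)
  show "1 \<notin> ord_ideal F 1" by (simp add: ord_ideal_def)
  fix a b :: "('a, 'b) mpoly" assume "a * b \<in> ord_ideal F 1"
  then show "a \<in> ord_ideal F 1 \<or> b \<in> ord_ideal F 1" using ord_ideal_cancel[of a F b 1] by metis
qed

text \<open>The fixed factor \<open>g\<close> lets the same reduction to monomials serve plain
  membership, with \<open>g = 1\<close>, and membership after localization.\<close>

lemma in_ideal_by_monoms:
  assumes J: "is_ideal J" and "\<And>a. a \<in> keys f \<Longrightarrow> g * monom a \<in> J"
  shows "g * f \<in> J"
proof -
  have "g * f = (\<Sum>a\<in>keys f. g * single a (lookup f a))"
    by (simp only: sum_distrib_left[symmetric] poly_mapping_eq_sum_single)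
  moreover have "g * single a (lookup f a) = single 0 (lookup f a) * (g * monom a)" for a
    by (subst single_eq_const_mult_monom) (simp only: mult.left_commute)
  moreover have "single 0 (lookup f a) * (g * monom a) \<in> J" if "a \<in> keys f" for a
    using assms(2)[OF that] by (rule is_idealD(3)[OF J])
  ultimately show ?thesis using J by (simp add: is_ideal_sum)
qed

lemma ord_ideal_1_subset:
  fixes J :: "('v::finite, 'k::field) mpoly set"
  assumes J: "is_ideal J" and vars: "\<And>v. v \<in> F \<Longrightarrow> var v \<in> J"
  shows "ord_ideal F 1 \<subseteq> J"
proof
  fix f :: "('v, 'k) mpoly" assume f: "f \<in> ord_ideal F 1"
  have "1 * monom a \<in> J" if "a \<in> keys f" for a
  proof -
    have "deg_on F a \<noteq> 0" using f that by (auto simp: ord_ideal_def)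
    then obtain v where "v \<in> F" "lookup a v \<noteq> 0" unfolding deg_on_def by (meson sum.neutral)
    then show ?thesis
      using is_idealD(4)[OF J vars] by (simp add: monom_decompose_var(2)[of a v])
  qed
  then have "1 * f \<in> J" by (rule in_ideal_by_monoms[OF J])
  then show "f \<in> J" by simp
qed

section \<open>Minimal primes of monomial ideals and localization\<close>

lemma monom_in_prime_ideal:
  fixes P :: "('v::finite, 'k::field) mpoly set"
  assumes P: "is_prime_ideal P" and "monom m \<in> P"
  shows "\<exists>v. lookup m v \<noteq> 0 \<and> var v \<in> P"
  using assms(2)
proof (induction "deg_on UNIV m" arbitrary: m rule: less_induct)
  case less
  have "m \<noteq> 0" using P less.prems by (auto simp: monom_0 is_prime_ideal_def)
  then obtain v where v: "lookup m v \<noteq> 0" by (metis poly_mapping_eqI lookup_zero)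
  let ?m = "m - single v 1"
  have "deg_on UNIV m = 1 + deg_on UNIV ?m"
    using arg_cong[OF monom_decompose_var(1)[OF v], of "deg_on UNIV"]
    unfolding deg_on_add deg_on_single by simp
  moreover have "var v \<in> P \<or> monom ?m \<in> P"
    using less.prems P unfolding monom_decompose_var(2)[OF v] is_prime_ideal_def by blast
  moreover have "lookup m w \<noteq> 0" if "lookup ?m w \<noteq> 0" for w
    using that by (simp add: lookup_minus)
  ultimately show ?case using less.hyps[of ?m] v by auto
qed

text \<open>\<open>F\<close> is a minimal vertex cover of the supports of \<open>G\<close>: it meets
  every support, and dropping \<open>v\<close> leaves some generator \<open>m\<close>
  uncovered.\<close>

lemma minimal_prime_monomial_ideal:
  fixes P :: "('v::finite, 'k::field) mpoly set"
  assumes P: "P \<in> minimal_primes (ideal_gen (monom ` G))"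
  defines "F \<equiv> {v. var v \<in> P}"
  shows "P = ord_ideal F 1"
    and "v \<in> F \<Longrightarrow> \<exists>m\<in>G. \<forall>w\<in>F. w \<noteq> v \<longrightarrow> lookup m w = 0"
proof -
  let ?I = "ideal_gen (monom ` G)"
  have prime: "is_prime_ideal P" and IP: "?I \<subseteq> P"
    and min: "\<And>Q. is_prime_ideal Q \<Longrightarrow> ?I \<subseteq> Q \<Longrightarrow> Q \<subseteq> P \<Longrightarrow> Q = P"
    using P by (auto simp: minimal_primes_def)
  have P': "is_ideal P" using prime by (simp add: is_prime_ideal_def)
  \<comment> \<open>A subset of \<open>F\<close> that still covers all supports gives a prime
    between \<open>?I\<close> and \<open>P\<close>, hence \<open>P\<close> itself.\<close>
  have minimal: "P = ord_ideal F' 1" if F': "F' \<subseteq> F" "\<And>m. m \<in> G \<Longrightarrow> \<exists>w\<in>F'. lookup m w \<noteq> 0" for F'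
  proof -
    have "?I \<subseteq> ord_ideal F' 1"
    proof (intro ideal_gen_least is_ideal_ord_ideal image_subsetI)
      fix m assume "m \<in> G"
      then obtain w where w: "w \<in> F'" "lookup m w \<noteq> 0" using F'(2) by metis
      have "lookup m w \<le> deg_on F' m"
        unfolding deg_on_def using w(1) by (intro member_le_sum) auto
      then show "monom m \<in> ord_ideal F' 1" using w(2) by (simp add: monom_in_ord_ideal_iff)
    qed
    moreover have "ord_ideal F' 1 \<subseteq> P"
      using F'(1) by (intro ord_ideal_1_subset P') (auto simp: F_def)
    ultimately show ?thesis using min[OF is_prime_ideal_ord_ideal] by metis
  qed
  have cover: "\<exists>w\<in>F. lookup m w \<noteq> 0" if "m \<in> G" for m
  proof -
    have "monom m \<in> P" using ideal_gen_superset[of "monom ` G"] IP that by auto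
    then show ?thesis using monom_in_prime_ideal[OF prime] by (auto simp: F_def)
  qed
  show "P = ord_ideal F 1" using cover by (intro minimal) auto
  show "\<exists>m\<in>G. \<forall>w\<in>F. w \<noteq> v \<longrightarrow> lookup m w = 0" if v: "v \<in> F"
  proof (rule ccontr)
    assume no: "\<not> ?thesis"
    have "P = ord_ideal (F - {v}) 1"
    proof (rule minimal)
      fix m assume "m \<in> G"
      then show "\<exists>w\<in>F - {v}. lookup m w \<noteq> 0" using no by auto
    qed auto
    moreover have "var v \<in> P" using v by (simp add: F_def)
    ultimately show False by (simp add: var_def monom_in_ord_ideal_iff deg_on_single)
  qed
qed

lemma is_ideal_ideal_pow: "is_ideal (ideal_pow I t)"
  by (cases t) (simp_all add: is_ideal_ideal_gen, simp add: is_ideal_def)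

text \<open>Inverting the variables outside \<open>F\<close> turns \<open>I\<close> into the ideal generated by the variables
  in \<open>F\<close>; \<open>monom c\<close> is the product of the inverted variables.\<close>

lemma localized_component_ideal_pow:
  fixes G :: "('v::finite \<Rightarrow>\<^sub>0 nat) set"
  assumes sqfree: "\<And>m v. m \<in> G \<Longrightarrow> lookup m v \<le> 1"
    and P: "P \<in> minimal_primes (ideal_gen (monom ` G) :: ('v, 'k::field) mpoly set)"
  shows "localized_component (ideal_pow (ideal_gen (monom ` G)) t) P = ord_ideal {v. var v \<in> P} t"
proof
  define I where "I = (ideal_gen (monom ` G) :: ('v, 'k) mpoly set)"
  define F where "F = {v. var v \<in> P}"
  have PF: "P = ord_ideal F 1"
    unfolding F_def by (rule minimal_prime_monomial_ideal(1)[OF P])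
  have IF: "I \<subseteq> ord_ideal F 1"
    using P unfolding PF[symmetric] I_def minimal_primes_def by simp
  \<comment> \<open>Once this is known, a multiplier outside \<open>P\<close> has order 0 along
    \<open>F\<close> and can be cancelled.\<close>
  have "ideal_pow I t \<subseteq> ord_ideal F t"
  proof (induction t)
    case 0
    then show ?case by (auto simp: ord_ideal_def)
  next
    case (Suc t)
    have "a * b \<in> ord_ideal F (Suc t)" if "a \<in> I" "b \<in> ideal_pow I t" for a b
      using ord_ideal_mult[of a F 1 b t] that IF Suc.IH by auto
    then show ?case
      unfolding ideal_pow.simps by (intro ideal_gen_least is_ideal_ord_ideal) auto
  qed
  then show "localized_component (ideal_pow (ideal_gen (monom ` G)) t) P \<subseteq> ord_ideal {v. var v \<in> P} t"
    unfolding localized_component_def I_def[symmetric] F_def[symmetric]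
  proof clarify
    fix f g assume "g \<notin> P" "g * f \<in> ideal_pow I t" "ideal_pow I t \<subseteq> ord_ideal F t"
    then show "f \<in> ord_ideal F t" using ord_ideal_cancel[of g F f t] PF by auto
  qed
  define c where "c = (\<Sum>w\<in>- F. single w (1::nat))"
  have c: "lookup c v = (if v \<in> F then 0 else 1)" for v
    by (simp add: c_def lookup_sum lookup_single when_def)
  have cvI: "monom c * var v \<in> I" if v: "v \<in> F" for v
  proof -
    obtain m where m: "m \<in> G" "\<And>w. w \<in> F \<Longrightarrow> w \<noteq> v \<Longrightarrow> lookup m w = 0"
      using minimal_prime_monomial_ideal(2)[OF P] v unfolding F_def by blast
    let ?e = "c + single v 1"
    have "lookup m w \<le> lookup ?e w" for w
      \<comment> \<open>Squarefreeness is used here: outside \<open>F\<close> the exponents of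
        \<open>m\<close>, at most 1, are matched by \<open>c\<close>, and inside \<open>F\<close>
        only \<open>v\<close> can occur.\<close>
      using m(2)[of w] sqfree[OF m(1), of w] by (auto simp: lookup_add c lookup_single when_def)
    then have "monom ?e = monom m * (monom (?e - m) :: ('v, 'k) mpoly)"
      by (simp only: monom_add[symmetric] add_diff_le)
    moreover have "monom m \<in> I" unfolding I_def using ideal_gen_superset m(1) by blast
    ultimately have "monom ?e \<in> I"
      unfolding I_def using is_idealD(4)[OF is_ideal_ideal_gen] by metis
    then show ?thesis by (simp add: var_def monom_add)
  qed
  \<comment> \<open>Each of \<open>t\<close> variables from \<open>F\<close> dividing the monomial,
    counted with multiplicity, is paired with one copy of \<open>monom c\<close> to give a factor in
    \<open>I\<close>.\<close>
  have pow: "monom c ^ t * monom a \<in> ideal_pow I t" if "t \<le> deg_on F a" for a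
    using that
  proof (induction t arbitrary: a)
    case 0
    then show ?case by simp
  next
    case (Suc t)
    then have "deg_on F a \<noteq> 0" by simp
    then obtain v where v: "v \<in> F" "lookup a v \<noteq> 0" unfolding deg_on_def
      by (meson sum.neutral)
    let ?a = "a - single v 1"
    have "deg_on F a = 1 + deg_on F ?a"
      using arg_cong[OF monom_decompose_var(1)[OF v(2)], of "deg_on F"] v(1)
      unfolding deg_on_add deg_on_single by simp
    then have "monom c ^ t * monom ?a \<in> ideal_pow I t" using Suc by simp
    moreover have "monom c ^ Suc t * monom a =
        (monom c * var v) * (monom c ^ t * (monom ?a :: ('v, 'k) mpoly))"
      unfolding monom_decompose_var(2)[OF v(2)] by (simp add: algebra_simps)
    ultimately have "monom c ^ Suc t * monom a \<in> {a * b |a b. a \<in> I \<and> b \<in> ideal_pow I t}"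
      using cvI[OF v(1)] by blast
    then show ?case
      unfolding ideal_pow.simps by (rule subsetD[OF ideal_gen_superset])
  qed
  have prime: "is_prime_ideal P" using P unfolding minimal_primes_def by simp
  have "monom c \<notin> P" by (simp add: PF monom_in_ord_ideal_iff deg_on_def c)
  then have "monom c ^ t \<notin> P"
    using prime by (induction t) (auto simp: is_prime_ideal_def)
  moreover have "monom c ^ t * f \<in> ideal_pow I t" if "f \<in> ord_ideal F t" for f
    by (rule in_ideal_by_monoms[OF is_ideal_ideal_pow pow])
      (use that in \<open>simp add: ord_ideal_def\<close>)
  ultimately show "ord_ideal {v. var v \<in> P} t \<subseteq>
      localized_component (ideal_pow (ideal_gen (monom ` G)) t) P"
    unfolding I_def[symmetric] F_def[symmetric] localized_component_def
    by (intro subsetI CollectI exI[of _ "monom c ^ t"]) simp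
qed

text \<open>One family, independent of \<open>t\<close>, describes all symbolic powers at once; this
  makes different exponents comparable.\<close>

lemma symbolic_power_squarefree:
  fixes I :: "('v::finite, 'k::field) mpoly set"
  assumes "squarefree_monomial_ideal I"
  shows "\<exists>\<F>. \<forall>t. symbolic_power I t = (\<Inter>F\<in>\<F>. ord_ideal F t)"
proof -
  obtain G where G: "\<And>m v. m \<in> G \<Longrightarrow> lookup m v \<le> 1" "I = ideal_gen (monom ` G)"
    using assms by (auto simp: squarefree_monomial_ideal_def)
  have "symbolic_power I t = (\<Inter>F\<in>(\<lambda>P. {v. var v \<in> P}) ` minimal_primes I. ord_ideal F t)" for t
    unfolding symbolic_power_def G(2) image_image
    by (intro arg_cong[where f = Inter] image_cong refl localized_component_ideal_pow G(1))
  then show ?thesis by blast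
qed

section \<open>The endomorphism raising every variable to a power\<close>

definition scale :: "nat \<Rightarrow> ('v \<Rightarrow>\<^sub>0 nat) \<Rightarrow> ('v \<Rightarrow>\<^sub>0 nat)" where
  "scale m a = Poly_Mapping.map ((*) m) a"

lemma lookup_scale [simp]: "lookup (scale m a) v = m * lookup a v"
  by (simp add: scale_def Poly_Mapping.map.rep_eq when_def)

lemma scale_add: "scale m (a + b) = scale m a + scale m b"
  by (rule poly_mapping_eqI) (simp add: lookup_add algebra_simps)

lemma scale_0 [simp]: "scale m 0 = 0"
  by (rule poly_mapping_eqI) simp

lemma inj_scale: "m > 0 \<Longrightarrow> inj (scale m)"
  by (rule injI, rule poly_mapping_eqI) (metis lookup_scale mult_cancel1 not_gr_zero)

lemma deg_on_scale: "deg_on F (scale m a) = m * deg_on F a"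
  by (simp add: deg_on_def sum_distrib_left)

definition subst_pow :: "nat \<Rightarrow> ('v, 'k::field) mpoly \<Rightarrow> ('v, 'k) mpoly" where
  "subst_pow m f = (\<Sum>a\<in>keys f. single (scale m a) (lookup f a))"

text \<open>The splitting of \<^term>\<open>subst_pow m\<close>: keep the monomials all of whose exponents are divisible
  by \<open>m\<close>.\<close>

definition contract_pow :: "nat \<Rightarrow> ('v, 'k::field) mpoly \<Rightarrow> ('v, 'k) mpoly" where
  "contract_pow m f = Poly_Mapping.map_key (scale m) f"

context
  fixes m :: nat
  assumes m: "m > 0"
begin

lemma lookup_contract_pow: "lookup (contract_pow m f) a = lookup f (scale m a)"
  by (simp add: contract_pow_def map_key.rep_eq[OF inj_scale[OF m]])

lemma lookup_subst_pow: "lookup (subst_pow m f) (scale m a) = lookup f a"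
proof -
  have "lookup (subst_pow m f) (scale m a) = (\<Sum>b\<in>keys f. if b = a then lookup f b else 0)"
    unfolding subst_pow_def lookup_sum
    by (intro sum.cong) (auto simp: lookup_single when_def inj_eq[OF inj_scale[OF m]])
  then show ?thesis by (auto simp: in_keys_iff)
qed

lemma lookup_subst_pow_outside:
  assumes "b \<notin> range (scale m)"
  shows "lookup (subst_pow m f) b = 0"
  unfolding subst_pow_def lookup_sum
  using assms by (intro sum.neutral) (auto simp: lookup_single when_def)

lemma keys_subst_pow: "keys (subst_pow m f) = scale m ` keys f"
proof (rule set_eqI)
  fix b
  show "b \<in> keys (subst_pow m f) \<longleftrightarrow> b \<in> scale m ` keys f"
  proof (cases "b \<in> range (scale m)")
    case True
    then show ?thesis by (auto simp: in_keys_iff lookup_subst_pow)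
  next
    case False
    then show ?thesis by (auto simp: in_keys_iff lookup_subst_pow_outside)
  qed
qed

lemma contract_subst_pow: "contract_pow m (subst_pow m f) = f"
  by (rule poly_mapping_eqI) (simp add: lookup_contract_pow lookup_subst_pow)

lemma contract_pow_add: "contract_pow m (f + g) = contract_pow m f + contract_pow m g"
  by (rule poly_mapping_eqI) (simp add: lookup_contract_pow lookup_add)

lemma subst_pow_add: "subst_pow m (f + g) = subst_pow m f + subst_pow m g"
proof (rule poly_mapping_eqI)
  fix b
  show "lookup (subst_pow m (f + g)) b = lookup (subst_pow m f + subst_pow m g) b"
    by (cases "b \<in> range (scale m)") (auto simp: lookup_add lookup_subst_pow lookup_subst_pow_outside)
qed

lemma subst_pow_0 [simp]: "subst_pow m 0 = 0"
  by (simp add: subst_pow_def)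

lemma contract_pow_0 [simp]: "contract_pow m 0 = 0"
  by (rule poly_mapping_eqI) (simp add: lookup_contract_pow)

lemma subst_pow_single: "subst_pow m (single a c) = single (scale m a) c"
  by (simp add: subst_pow_def)

lemma subst_pow_1: "subst_pow m 1 = 1"
  using subst_pow_single[of 0 1] by simp

lemma subst_pow_mult: "subst_pow m (f * g) = subst_pow m f * subst_pow m g"
proof (induction f rule: poly_mapping_add_induct)
  case (single a c)
  show ?case
    by (induction g rule: poly_mapping_add_induct)
      (simp_all add: subst_pow_single mult_single scale_add subst_pow_add distrib_left)
qed (simp_all add: subst_pow_add distrib_right)

text \<open>The splitting is linear over the image of \<open>subst_pow m\<close>. By additivity it
  suffices to treat monomials.\<close>

lemma contract_pow_mult_subst_pow: "contract_pow m (f * subst_pow m g) = contract_pow m f * g"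
proof (induction f rule: poly_mapping_add_induct)
  case (single b c)
  show ?case
  proof (induction g rule: poly_mapping_add_induct)
    case (single a d)
    show ?case
    proof (cases "b \<in> range (scale m)")
      case True
      then obtain b' where b: "b = scale m b'" by auto
      show ?thesis
        unfolding b subst_pow_single mult_single scale_add[symmetric] contract_pow_def
          map_key_single[OF inj_scale[OF m]] ..
    next
      case False
      \<comment> \<open>If \<open>b\<close> has an exponent not divisible by \<open>m\<close>, so
        does the sum, and both sides vanish.\<close>
      have "b + scale m a \<noteq> scale m x" for x
      proof
        assume eq: "b + scale m a = scale m x"
        \<comment> \<open>Truncated subtraction is harmless: \<open>eq\<close> gives
          \<open>m * lookup a v \<le> m * lookup x v\<close>.\<close>
        have "b = scale m (x - a)"
        proof (rule poly_mapping_eqI)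
          fix v
          have "lookup b v + m * lookup a v = m * lookup x v"
            using arg_cong[OF eq, of "\<lambda>e. lookup e v"] by (simp add: lookup_add)
          then show "lookup b v = lookup (scale m (x - a)) v"
            by (simp add: lookup_minus diff_mult_distrib2)
        qed
        then show False using False by simp
      qed
      then have "contract_pow m (single (b + scale m a) (c * d)) = 0"
        by (intro poly_mapping_eqI) (simp add: lookup_contract_pow lookup_single when_def)
      moreover have "contract_pow m (single b c) = 0"
        using False by (intro poly_mapping_eqI) (auto simp: lookup_contract_pow lookup_single when_def)
      ultimately show ?thesis by (simp add: subst_pow_single mult_single)
    qed
  qed (simp_all add: subst_pow_add contract_pow_add distrib_left)
qed (simp_all add: contract_pow_add distrib_right)

section \<open>Regular sequences under the endomorphism\<close>

lemma subst_pow_var: "subst_pow m (var v) = var v ^ m"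
proof -
  have "var v ^ n = (single (single v n) 1 :: ('v, 'k::field) mpoly)" for v :: 'v and n
    by (induction n) (simp_all add: var_def monom_def mult_single single_add[symmetric])
  moreover have "scale m (single v 1) = single v m"
    by (rule poly_mapping_eqI) (simp add: lookup_single when_def)
  ultimately show ?thesis by (metis subst_pow_single power_one_right)
qed

text \<open>A prime containing the powers \<open>var v ^ m\<close> contains the variables, so every
  prime over the image of \<open>max_ideal\<close> contains \<open>max_ideal\<close>.\<close>

lemma avoids_subst_pow:
  "avoids (subst_pow m ` (max_ideal :: ('v::finite, 'k::field) mpoly set)) max_ideal"
proof (rule avoids_image[OF wf_strict_superideals_mpoly])
  show "is_ideal max_ideal" unfolding max_ideal_def by (rule is_ideal_ideal_gen)
  fix P :: "('v, 'k) mpoly set"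
  assume P: "is_prime_ideal P" and sub: "subst_pow m ` max_ideal \<subseteq> P"
  have "var v \<in> P" for v
  proof -
    have "var v \<in> max_ideal" unfolding max_ideal_def using ideal_gen_superset by blast
    then have "var v ^ m \<in> P" using sub subst_pow_var by (metis image_subset_iff)
    moreover have "var v ^ n \<notin> P" if "var v \<notin> P" for n
      using that P by (induction n) (auto simp: is_prime_ideal_def)
    ultimately show ?thesis by blast
  qed
  then show "max_ideal \<subseteq> P"
    unfolding max_ideal_def using P by (intro ideal_gen_least) (auto simp: is_prime_ideal_def)
qed (simp_all add: subst_pow_1 subst_pow_add subst_pow_mult)

text \<open>Regularity of \<open>h\<close> modulo \<open>J'\<close> comes from applying
  \<open>subst_pow m\<close>, cancelling modulo \<open>J\<close>, and splitting back. Both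
  inclusions survive adjoining \<open>subst_pow m h\<close> to \<open>J\<close> and \<open>h\<close>
  to \<open>J'\<close>.\<close>

lemma reg_contract:
  assumes "is_ideal J" "is_ideal J'" "subst_pow m ` J' \<subseteq> J" "contract_pow m ` J \<subseteq> J'"
    and "reg (subst_pow m ` M) J ts"
  shows "\<exists>hs. length hs = length ts \<and> reg M J' hs"
  using assms
proof (induction ts arbitrary: J J')
  case Nil
  then show ?case by simp
next
  case (Cons t ts)
  have J: "is_ideal J" and J': "is_ideal J'" by fact+
  obtain h where h: "h \<in> M" "t = subst_pow m h" using Cons.prems(5) by auto
  let ?K = "ideal_gen (insert t J)" and ?K' = "ideal_gen (insert h J')"
  have "g \<in> J'" if "g * h \<in> J'" for g
  proof -
    have "subst_pow m g * t \<in> J" using that Cons.prems(3) by (auto simp: h subst_pow_mult[symmetric])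
    then have "subst_pow m g \<in> J" using Cons.prems(5) by simp
    then have "contract_pow m (subst_pow m g) \<in> J'" using Cons.prems(4) by blast
    then show ?thesis by (simp add: contract_subst_pow)
  qed
  moreover have "subst_pow m ` ?K' \<subseteq> ?K"
  proof clarify
    fix f assume "f \<in> ?K'"
    then obtain a r where a: "a \<in> J'" "f = a + r * h"
      unfolding ideal_gen_insert_ideal[OF J'] by blast
    then have "subst_pow m f = subst_pow m a + subst_pow m r * t" "subst_pow m a \<in> J"
      using Cons.prems(3) by (auto simp: h subst_pow_add subst_pow_mult)
    then show "subst_pow m f \<in> ?K" unfolding ideal_gen_insert_ideal[OF J] by blast
  qed
  \<comment> \<open>Linearity of the splitting sends \<open>r * t\<close> to
    \<open>contract_pow m r * h\<close>.\<close>
  moreover have "contract_pow m ` ?K \<subseteq> ?K'"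
  proof clarify
    fix f assume "f \<in> ?K"
    then obtain a r where a: "a \<in> J" "f = a + r * t"
      unfolding ideal_gen_insert_ideal[OF J] by blast
    then have "contract_pow m f = contract_pow m a + contract_pow m r * h" "contract_pow m a \<in> J'"
      using Cons.prems(4) by (auto simp: h contract_pow_add contract_pow_mult_subst_pow)
    then show "contract_pow m f \<in> ?K'" unfolding ideal_gen_insert_ideal[OF J'] by blast
  qed
  moreover have "reg (subst_pow m ` M) ?K ts" using Cons.prems(5) by simp
  ultimately obtain hs where "length hs = length ts" "reg M ?K' hs"
    using Cons.IH[OF is_ideal_ideal_gen is_ideal_ideal_gen] by blast
  then show ?case
    using h(1) \<open>\<And>g. g * h \<in> J' \<Longrightarrow> g \<in> J'\<close> by (intro exI[of _ "h # hs"]) simp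
qed

end

section \<open>Depth\<close>

lemma max_ideal_eq: "max_ideal = ord_ideal UNIV 1"
proof
  show "max_ideal \<subseteq> ord_ideal UNIV 1"
    unfolding max_ideal_def
    by (intro ideal_gen_least is_ideal_ord_ideal)
      (auto simp: var_def monom_in_ord_ideal_iff deg_on_single)
  show "ord_ideal UNIV 1 \<subseteq> max_ideal"
    unfolding max_ideal_def
    by (intro ord_ideal_1_subset is_ideal_ideal_gen subsetD[OF ideal_gen_superset] rangeI)
qed

lemma one_notin_max_ideal: "1 \<notin> (max_ideal :: ('v::finite, 'k::field) mpoly set)"
  unfolding max_ideal_eq by (simp add: ord_ideal_def)

text \<open>Properness is automatic: everything stays inside \<open>max_ideal\<close>.\<close>

lemma regular_seq_iff_reg:
  assumes "is_ideal J" "J \<subseteq> max_ideal"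
  shows "regular_seq J fs \<longleftrightarrow> reg max_ideal J fs"
proof -
  have "1 \<notin> ideal_gen (J \<union> set fs)" if "set fs \<subseteq> max_ideal"
    using ideal_gen_least[of max_ideal "J \<union> set fs"] assms(2) that one_notin_max_ideal
      is_ideal_ideal_gen unfolding max_ideal_def by blast
  then show ?thesis
    unfolding regular_seq_def ideal_sum_ideal_gen reg_iff[OF assms(1)] by blast
qed

text \<open>A regular sequence on \<open>R/J\<close> is exchanged for one in the image of
  \<open>subst_pow m\<close> and then pulled back to \<open>R/J'\<close>, keeping its
  length.\<close>

lemma depth_quot_mono:
  fixes J J' :: "('v::finite, 'k::field) mpoly set"
  assumes m: "m > 0" and J: "is_ideal J" and J': "is_ideal J'" "J' \<subseteq> max_ideal"
    and sub: "subst_pow m ` J' \<subseteq> J" "contract_pow m ` J \<subseteq> J'"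
  shows "depth_quot J \<le> depth_quot J'"
proof -
  have 1: "1 \<notin> J'" using J'(2) one_notin_max_ideal by blast
  \<comment> \<open>Since \<open>contract_pow m\<close> fixes 1, both depths are suprema rather than
    infinite by convention.\<close>
  then have "1 \<notin> J"
    using sub(2) contract_subst_pow[OF m, of 1] subst_pow_1[OF m]
    by (metis image_subset_iff)
  moreover have "enat (length fs) \<le> Sup {enat (length hs) |hs. regular_seq J' hs}"
    if fs: "regular_seq J fs" for fs
  proof -
    have "reg max_ideal J fs"
      using fs unfolding regular_seq_def ideal_sum_ideal_gen reg_iff[OF J] by blast
    then obtain ts where ts: "length ts = length fs" "reg (subst_pow m ` max_ideal) J ts"
      using reg_exchange[OF avoids_subst_pow[OF m] J] by blast
    obtain hs where "length hs = length fs" "reg max_ideal J' hs"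
      using reg_contract[OF m J J'(1) sub ts(2)] ts(1) by auto
    then show ?thesis
      unfolding regular_seq_iff_reg[OF J', symmetric] by (intro Sup_upper) (auto intro!: exI[of _ hs])
  qed
  ultimately show ?thesis using 1 by (auto simp: depth_quot_def intro!: Sup_least)
qed

theorem theorem2p7:
  fixes I :: "('v::finite, 'k::field) mpoly set"
  assumes "squarefree_monomial_ideal I"
    and "s \<ge> 1"
    and "t \<in> E_set s"
  shows "depth_quot (symbolic_power I s) \<ge> depth_quot (symbolic_power I t)"
proof (cases "1 \<in> symbolic_power I s")
  \<comment> \<open>The quotient is zero and its depth infinite by convention.\<close>
  case True
  then show ?thesis by (simp add: depth_quot_def)
next
  case False
  obtain \<F> where \<F>: "\<And>t. symbolic_power I t = (\<Inter>F\<in>\<F>. ord_ideal F t)"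
    using symbolic_power_squarefree[OF assms(1)] by blast
  \<comment> \<open>\<open>m\<close> is the index \<open>i\<close> of an interval of
    \<open>E_set s\<close> containing \<open>t\<close>.\<close>
  obtain m where m: "m > 0" "m * (s - 1) + 1 \<le> t" "t \<le> m * s"
    using assms(3) that by (auto simp: E_set_def Suc_le_eq)
  \<comment> \<open>\<open>s\<close> is the ceiling of \<open>t / m\<close>, so multiplying
    \<open>F\<close>-degrees by \<open>m\<close> matches the bound \<open>s\<close> with the bound
    \<open>t\<close>.\<close>
  have deg: "t \<le> m * n \<longleftrightarrow> s \<le> n" for n
  proof
    assume "t \<le> m * n"
    then have "m * (s - 1) < m * n" using m(2) by linarith
    then have "s - 1 < n" by simp
    then show "s \<le> n" by simp
  next
    assume "s \<le> n"
    then show "t \<le> m * n" using m(3) mult_le_mono2[of s n m] by linarith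
  qed
  have "is_ideal (symbolic_power I u)" for u
    unfolding \<F> is_ideal_def
    by (auto intro: is_idealD[OF is_ideal_ord_ideal])
  moreover have "symbolic_power I s \<subseteq> max_ideal"
  proof -
    \<comment> \<open>The unit case being excluded, the family has a member \<open>F\<close>;
      \<open>s \<ge> 1\<close> then rules out constant terms.\<close>
    obtain F where "F \<in> \<F>" using False by (auto simp: \<F>)
    moreover have "(ord_ideal F s :: ('v, 'k) mpoly set) \<subseteq> ord_ideal UNIV 1"
    proof -
      have "deg_on F a \<le> deg_on UNIV a" for a
        unfolding deg_on_def by (intro sum_mono2) auto
      then have "1 \<le> deg_on UNIV a" if "s \<le> deg_on F a" for a
        using assms(2) that by (meson order_trans)
      then show ?thesis by (auto simp: ord_ideal_def)
    qed
    ultimately show ?thesis unfolding \<F> max_ideal_eq by blast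
  qed
  moreover have "subst_pow m ` symbolic_power I s \<subseteq> symbolic_power I t"
    by (auto simp: \<F> ord_ideal_def keys_subst_pow[OF m(1)] deg_on_scale deg)
  moreover have "contract_pow m ` symbolic_power I t \<subseteq> symbolic_power I s"
  proof -
    have "contract_pow m f \<in> ord_ideal F s" if "f \<in> ord_ideal F t" for f F
      unfolding ord_ideal_def
    proof clarify
      fix a assume "a \<in> keys (contract_pow m f)"
      then have "scale m a \<in> keys f" by (simp add: in_keys_iff lookup_contract_pow[OF m(1)])
      then show "s \<le> deg_on F a"
        using that by (auto simp: ord_ideal_def deg_on_scale deg[symmetric])
    qed
    then show ?thesis by (auto simp: \<F>)
  qed
  ultimately show ?thesis using depth_quot_mono[OF m(1)] by blast
qed

end
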